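(* Let $k,m,n\in\mathbb{N}$ with $k,n\ge 3$ and $m\ge 2$, and let $LP_{n,m}$ be any long brush graph. Then $LP_{n,m}$ is $k$-distance magic if and only if $m(m-1)\le 2n$ and $k=n$.
   Context: All graphs are finite, simple and undirected; $d(u,v)$ is graph distance. For $u\in V(G)$ and $k\in\mathbb{N}$, $\partial N_k(u)=\{v\in V(G): d(u,v)=k\}$. For a graph $G$ of order $p\ge3$, a $k$-distance magic labeling ($k$-DML) is a bijection $f:V(G)\to\{1,\dots,p\}$ together with a constant $M$ such that $\sum_{w\in\partial N_k(u)} f(w)=M$ for every vertex $u$ with $\partial N_k(u)\neq\emptyset$; moreover $G$ is required to contain at least one pair of vertices at distance $k$. $G$ is $k$-distance magic if it has a $k$-DML. A long brush $LP_{n,m}$ ($m,n\in\mathbb{N}$, $m+n\ge3$) is a graph with vertex set $\{u_1,\dots,u_n,v_1,\dots,v_m\}$ whose edges are the path edges $u_iu_{i+1}$ ($1\le i<n$), the edges $u_1v_i$ ($1\le i\le m$), and an arbitrary set of edges among $v_1,\dots,v_m$ (so the induced subgraph $\langle v_1,\dots,v_m\rangle$ is arbitrary). *)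

theory Defs
  imports "Graph_Theory.Shortest_Path"
begin

text \<open>
  Finite simple undirected graphs are the finite, loop-free, symmetric digraphs without
  parallel arcs of the locale \<^locale>\<open>graph\<close>: an undirected edge is a pair of opposite arcs.
\<close>

context graph
begin

definition dist_nbhd :: "nat \<Rightarrow> 'a \<Rightarrow> 'a set" ("\<partial>N") where
  "\<partial>N k u = {v \<in> verts G. \<mu> (\<lambda>_. 1) u v = ereal (real k)}"
  \<comment> \<open>With unit weights the cost of a walk is its length, so \<open>\<mu>\<close> is the graph distance
      (and infinite for vertices in different components).\<close>

definition distance_magic_labeling :: "nat \<Rightarrow> ('a \<Rightarrow> nat) \<Rightarrow> nat \<Rightarrow> bool" where
  "distance_magic_labeling k f M \<longleftrightarrow>
     3 \<le> card (verts G) \<and>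
     (\<exists>u\<in>verts G. \<exists>v\<in>verts G. v \<in> \<partial>N k u) \<and>
     bij_betw f (verts G) {1..card (verts G)} \<and>
     (\<forall>u\<in>verts G. \<partial>N k u \<noteq> {} \<longrightarrow> (\<Sum>w\<in>\<partial>N k u. f w) = M)"

definition distance_magic :: "nat \<Rightarrow> bool" where
  "distance_magic k \<longleftrightarrow> (\<exists>f M. distance_magic_labeling k f M)"

text \<open>
  The graph is a long brush with path \<open>u 1, \<dots>, u n\<close> and bristles \<open>v 1, \<dots>, v m\<close>.
  The adjacencies among the \<open>v j\<close> are deliberately left unconstrained. Only arcs from
  \<open>u i\<close> to \<open>v j\<close> are mentioned, since adjacency in a \<^locale>\<open>graph\<close> is symmetric.
\<close>

definition long_brush :: "nat \<Rightarrow> nat \<Rightarrow> bool" where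
  "long_brush n m \<longleftrightarrow>
     1 \<le> n \<and> 1 \<le> m \<and> 3 \<le> m + n \<and>
     (\<exists>u v. inj_on u {1..n} \<and> inj_on v {1..m} \<and>
        u ` {1..n} \<inter> v ` {1..m} = {} \<and>
        verts G = u ` {1..n} \<union> v ` {1..m} \<and>
        (\<forall>i\<in>{1..n}. \<forall>j\<in>{1..n}. u i \<rightarrow> u j \<longleftrightarrow> j = i + 1 \<or> i = j + 1) \<and>
        (\<forall>i\<in>{1..n}. \<forall>j\<in>{1..m}. u i \<rightarrow> v j \<longleftrightarrow> i = 1))"

end

end

theory Submission
  imports Defs "HOL-Combinatorics.Transposition"
begin

text \<open>
  Let the height of \<open>u i\<close> be \<open>i\<close> and that of every bristle be \<open>0\<close>. Two vertices are at
  distance \<open>k \<ge> 3\<close> iff their heights differ by \<open>k\<close>: adjacent heights differ by at most one,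
  and only bristles, which are within distance \<open>2\<close> of each other, share a height. Hence
  \<open>k \<le> n\<close> and the bristles have \<open>u k\<close> as the only vertex at distance \<open>k\<close>. If \<open>k < n\<close>, then
  \<open>u (k + 1)\<close> is the only vertex at distance \<open>k\<close> from \<open>u 1\<close>, against injectivity. If \<open>k = n\<close>,
  the only condition left is that the labels of the bristles add up to the label of \<open>u n\<close>;
  this forces \<open>m (m + 1) / 2 \<le> m + n\<close>, and under that inequality the bristles may be
  labelled \<open>1, \<dots>, m\<close>.
\<close>

text \<open>Keeps \<open>1\<close> from being rewritten to \<open>Suc 0\<close>, so that
  \<open>u 1\<close>, \<open>v 1\<close> and intervals starting at \<open>1\<close> retain the form
  in which the facts are stated.\<close>

declare One_nat_def [simp del]

text \<open>By induction on the maximum: \<open>b\<close> exceeds all elements of \<open>A\<close>,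
  which are positive, so \<open>card A + 1 \<le> b\<close>, and this is the summand that the left
  side gains.\<close>

lemma sum_atLeast1_card_le:
  fixes S :: "nat set"
  assumes "finite S" and "0 \<notin> S"
  shows "\<Sum>{1..card S} \<le> \<Sum>S"
  using assms
proof (induction S rule: finite_linorder_max_induct)
  case (insert b A)
  have "A \<subseteq> {1..<b}"
  proof
    fix a assume "a \<in> A"
    then have "a \<noteq> 0" "a < b" using insert.hyps insert.prems by (metis insertI2, blast)
    then show "a \<in> {1..<b}" by simp
  qed
  then have "card A \<le> b - 1"
    using card_mono[of "{1..<b}" A] by simp
  moreover have "0 < b"
    using insert.prems by (cases b) auto
  moreover have "b \<notin> A"
    using insert.hyps by blast
  ultimately show ?case
    using insert by simp
qed simp

section \<open>Bounds on the distance for unit weights\<close>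

context wf_digraph
begin

text \<open>Gives upper bounds from explicit sequences of vertices, which may repeat.\<close>

lemma unit_dist_le_steps:
  assumes "w 0 \<in> verts G" and "\<And>i. i < d \<Longrightarrow> w i \<rightarrow> w (Suc i)"
  shows "\<mu> (\<lambda>_. 1) (w 0) (w d) \<le> ereal (real d)"
proof -
  have "\<exists>p. awalk (w 0) p (w d) \<and> length p = d"
    using assms
  proof (induction d)
    case 0
    then show ?case by (auto simp: awalk_Nil_iff)
  next
    case (Suc d)
    then obtain p where p: "awalk (w 0) p (w d)" "length p = d" by fastforce
    from Suc.prems(2)[of d] obtain e where "e \<in> arcs G" "tail G e = w d" "head G e = w (Suc d)"
      by (auto simp: arcs_ends_def arc_to_ends_def)
    then have "awalk (w d) [e] (w (Suc d))"
      using arc_implies_awalk by metis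
    with p show ?case
      using awalk_appendI by (intro exI[of _ "p @ [e]"]) auto
  qed
  then obtain p where p: "awalk (w 0) p (w d)" "length p = d" by blast
  then have "awalk_cost (\<lambda>_. 1) p = real d"
    by (simp add: awalk_cost_def sum_list_triv)
  with min_cost_le_walk_cost[OF p(1), of "\<lambda>_. 1"] show ?thesis by simp
qed

text \<open>Each arc changes \<open>h\<close> by at most 1, so every walk from \<open>x\<close> to
  \<open>y\<close> costs at least the total change. Without any walk the infimum is
  infinite.\<close>

lemma Lipschitz_le_unit_dist:
  fixes h :: "'a \<Rightarrow> real"
  assumes "\<And>x y. x \<rightarrow> y \<Longrightarrow> \<bar>h x - h y\<bar> \<le> 1"
  shows "ereal \<bar>h x - h y\<bar> \<le> \<mu> (\<lambda>_. 1) x y"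
proof -
  have "\<bar>h x - h y\<bar> \<le> awalk_cost (\<lambda>_. 1) p" if "awalk x p y" for p
    using that
  proof (induction p arbitrary: x)
    case Nil
    then show ?case by (auto simp: awalk_Nil_iff)
  next
    case (Cons e p)
    then have "x \<rightarrow> head G e" "\<bar>h (head G e) - h y\<bar> \<le> awalk_cost (\<lambda>_. 1) p"
      by (auto simp: awalk_Cons_iff intro: in_arcs_imp_in_arcs_ends)
    with assms[of x "head G e"] show ?case by simp
  qed
  then show ?thesis
    unfolding \<mu>_def by (auto intro: INF_greatest)
qed

end

section \<open>Heights and distances in a long brush\<close>

locale long_brush_graph = graph +
  fixes u v :: "nat \<Rightarrow> 'a" and n m :: nat
  assumes n_ge: "3 \<le> n" and m_ge: "2 \<le> m"
    and inj_u: "inj_on u {1..n}" and inj_v: "inj_on v {1..m}"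
    and disjoint_uv: "u ` {1..n} \<inter> v ` {1..m} = {}"
    and verts_eq: "verts G = u ` {1..n} \<union> v ` {1..m}"
    and adj_uu: "i \<in> {1..n} \<Longrightarrow> j \<in> {1..n} \<Longrightarrow> u i \<rightarrow> u j \<longleftrightarrow> j = i + 1 \<or> i = j + 1"
    and adj_uv: "i \<in> {1..n} \<Longrightarrow> j \<in> {1..m} \<Longrightarrow> u i \<rightarrow> v j \<longleftrightarrow> i = 1"
begin

lemma card_verts: "card (verts G) = m + n"
  using disjoint_uv by (simp add: verts_eq card_Un_disjoint card_image inj_u inj_v)

text \<open>Meaningful only on \<open>verts G\<close>: elsewhere the inverse of \<open>u\<close> is
  unspecified.\<close>

definition height :: "'a \<Rightarrow> nat" where
  "height x = (if x \<in> v ` {1..m} then 0 else the_inv_into {1..n} u x)"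

lemma height_u [simp]: "i \<in> {1..n} \<Longrightarrow> height (u i) = i"
  using disjoint_uv by (subst height_def) (auto simp: the_inv_into_f_f[OF inj_u] disjoint_iff)

lemma height_v [simp]: "j \<in> {1..m} \<Longrightarrow> height (v j) = 0"
  by (simp add: height_def)

lemma height_le: "x \<in> verts G \<Longrightarrow> height x \<le> n"
  by (auto simp: verts_eq)

lemma adj_sym: "x \<rightarrow> y \<Longrightarrow> y \<rightarrow> x"
  using sym_arcs by (auto simp: symmetric_def elim: symE)

text \<open>The arbitrary edges among bristles are harmless, since both ends have height 0.\<close>

lemma height_adj: "x \<rightarrow> y \<Longrightarrow> \<bar>real (height x) - real (height y)\<bar> \<le> 1"
proof -
  assume xy: "x \<rightarrow> y"
  then have "x \<in> verts G" "y \<in> verts G" by (auto dest: adj_in_verts)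
  then consider
      (uu) i j where "i \<in> {1..n}" "x = u i" "j \<in> {1..n}" "y = u j"
    | (uv) i j where "i \<in> {1..n}" "x = u i" "j \<in> {1..m}" "y = v j"
    | (vu) i j where "i \<in> {1..m}" "x = v i" "j \<in> {1..n}" "y = u j"
    | (vv) i j where "i \<in> {1..m}" "x = v i" "j \<in> {1..m}" "y = v j"
    unfolding verts_eq by blast
  then show ?thesis
  proof cases
    case uu
    with xy adj_uu[of i j] show ?thesis by auto
  next
    case uv
    with xy adj_uv[of i j] show ?thesis by auto
  next
    case vu
    with adj_sym[OF xy] adj_uv[of j i] show ?thesis by auto
  qed simp
qed

text \<open>The path completed by a bristle, which is placed at index \<open>0\<close>.\<close>

definition spine :: "nat \<Rightarrow> nat \<Rightarrow> 'a" where
  "spine j i = (if i = 0 then v j else u i)"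

lemma spine_in_verts: "j \<in> {1..m} \<Longrightarrow> i \<le> n \<Longrightarrow> spine j i \<in> verts G"
  by (auto simp: spine_def verts_eq)

lemma spine_adj:
  assumes "j \<in> {1..m}" and "i < n"
  shows "spine j i \<rightarrow> spine j (Suc i)"
proof (cases "i = 0")
  case True
  with assms adj_uv[of 1 j] show ?thesis by (auto simp: spine_def One_nat_def intro: adj_sym)
next
  case False
  with assms adj_uu[of i "Suc i"] show ?thesis by (auto simp: spine_def)
qed

lemma dist_spine_le:
  assumes j: "j \<in> {1..m}" and "a \<le> n" and "b \<le> n"
  shows "\<mu> (\<lambda>_. 1) (spine j a) (spine j b) \<le> ereal \<bar>real a - real b\<bar>"
proof (cases "a \<le> b")
  case True
  have "spine j (a + i) \<rightarrow> spine j (a + Suc i)" if "i < b - a" for i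
    using spine_adj[OF j, of "a + i"] assms that by simp
  with unit_dist_le_steps[of "\<lambda>i. spine j (a + i)" "b - a"] spine_in_verts[OF j \<open>a \<le> n\<close>] True
  show ?thesis by (simp add: of_nat_diff)
next
  case False
  \<comment> \<open>Going down uses the reversed arcs; \<open>i < a - b\<close> keeps the
    subtraction from truncating.\<close>
  have "spine j (a - i) \<rightarrow> spine j (a - Suc i)" if "i < a - b" for i
    using spine_adj[OF j, of "a - Suc i"] assms that by (auto intro: adj_sym simp: Suc_diff_Suc)
  with unit_dist_le_steps[of "\<lambda>i. spine j (a - i)" "a - b"] spine_in_verts[OF j \<open>a \<le> n\<close>] False
  show ?thesis by (simp add: of_nat_diff)
qed

lemma dist_bristles_le:
  assumes "i \<in> {1..m}" and "j \<in> {1..m}"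
  shows "\<mu> (\<lambda>_. 1) (v i) (v j) \<le> 2"
proof -
  \<comment> \<open>A detour through \<open>u 1\<close>, valid even for
    \<open>i = j\<close>.\<close>
  define w where "w t = (if t = 0 then v i else if t = 1 then u 1 else v j)" for t :: nat
  have "w t \<rightarrow> w (Suc t)" if "t < 2" for t
    using that assms n_ge adj_uv[of 1 i] adj_uv[of 1 j]
    by (auto simp: w_def intro: adj_sym)
  moreover have "w 0 \<in> verts G"
    using assms by (simp add: w_def verts_eq)
  ultimately show ?thesis
    using unit_dist_le_steps[of w 2] by (simp add: w_def)
qed

text \<open>On a common spine the upper and lower bounds meet, so the distance is the height
  difference. Two distinct bristles share no spine, but then both sides are false because
  \<open>k\<close> exceeds 2.\<close>

lemma dist_eq_iff_height:
  assumes "3 \<le> k" and x: "x \<in> verts G" and y: "y \<in> verts G"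
  shows "\<mu> (\<lambda>_. 1) x y = ereal (real k) \<longleftrightarrow> \<bar>real (height x) - real (height y)\<bar> = real k"
proof -
  have lower: "ereal \<bar>real (height x) - real (height y)\<bar> \<le> \<mu> (\<lambda>_. 1) x y"
    using Lipschitz_le_unit_dist[of "\<lambda>x. real (height x)"] height_adj by blast
  have spine_v: "spine j 0 = v j" for j
    by (simp add: spine_def)
  have spine_u: "spine j i = u i" if "i \<in> {1..n}" for i j
    using that by (simp add: spine_def)
  consider
      (spine) j a b where "j \<in> {1..m}" "a \<le> n" "b \<le> n" "x = spine j a" "y = spine j b"
    | (vv) i j where "i \<in> {1..m}" "x = v i" "j \<in> {1..m}" "y = v j"
  proof -
    consider
        (uu) i j where "i \<in> {1..n}" "x = u i" "j \<in> {1..n}" "y = u j"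
      | (uv) i j where "i \<in> {1..n}" "x = u i" "j \<in> {1..m}" "y = v j"
      | (vu) i j where "i \<in> {1..m}" "x = v i" "j \<in> {1..n}" "y = u j"
      | (vv) i j where "i \<in> {1..m}" "x = v i" "j \<in> {1..m}" "y = v j"
      using x y unfolding verts_eq by blast
    then show ?thesis
    proof cases
      case uu
      \<comment> \<open>Path vertices lie on every spine, so any bristle will do.\<close>
      then show ?thesis using that(1)[of 1 i j] m_ge spine_u by simp
    next
      case uv
      then show ?thesis using that(1)[of j i 0] spine_u spine_v by simp
    next
      case vu
      then show ?thesis using that(1)[of i 0 j] spine_u spine_v by simp
    next
      case vv
      then show ?thesis using that(2) by blast
    qed
  qed
  then show ?thesis
  proof cases
    case spine
    then have "height x = a" "height y = b" by (auto simp: spine_def)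
    with spine dist_spine_le[of j a b] lower
    have "\<mu> (\<lambda>_. 1) x y = ereal \<bar>real (height x) - real (height y)\<bar>"
      by (simp add: antisym)
    then show ?thesis by simp
  next
    case vv
    then have "\<mu> (\<lambda>_. 1) x y \<le> ereal 2"
      using dist_bristles_le by simp
    then have "\<mu> (\<lambda>_. 1) x y \<noteq> ereal (real k)"
      using \<open>3 \<le> k\<close> by auto
    with vv \<open>3 \<le> k\<close> show ?thesis by simp
  qed
qed

section \<open>The neighbourhoods that matter\<close>

lemma in_dist_nbhd_iff:
  assumes "3 \<le> k" and "x \<in> verts G"
  shows "y \<in> \<partial>N k x \<longleftrightarrow> y \<in> verts G \<and> (height y = height x + k \<or> height x = height y + k)"
  using assms dist_eq_iff_height[of k x y] unfolding dist_nbhd_def by auto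

lemma dist_nbhd_v:
  assumes "3 \<le> k" and "k \<le> n" and "j \<in> {1..m}"
  shows "\<partial>N k (v j) = {u k}"
proof -
  have "v j \<in> verts G" using assms by (simp add: verts_eq)
  with assms show ?thesis
    by (auto simp: in_dist_nbhd_iff verts_eq)
qed

lemma dist_nbhd_u_1:
  assumes "3 \<le> k" and "k < n"
  shows "\<partial>N k (u 1) = {u (k + 1)}"
proof -
  have 1: "1 \<in> {1..n}" "k + 1 \<in> {1..n}" using assms by auto
  then have "u 1 \<in> verts G" by (simp add: verts_eq)
  with assms 1 height_u[OF 1(1)] show ?thesis
    by (auto simp: in_dist_nbhd_iff verts_eq add.commute)
qed

lemma dist_nbhd_u_n: "\<partial>N n (u n) = v ` {1..m}"
proof -
  have "u n \<in> verts G" using n_ge by (simp add: verts_eq)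
  with n_ge show ?thesis
    by (auto simp: in_dist_nbhd_iff verts_eq)
qed

text \<open>Heights \<open>i + n\<close> and \<open>i - n\<close> both fall outside \<open>0\<close>
  to \<open>n\<close>, so these vertices put no condition on a labeling.\<close>

lemma dist_nbhd_u_less:
  assumes "i \<in> {1..<n}"
  shows "\<partial>N n (u i) = {}"
proof -
  have "u i \<in> verts G" using assms by (simp add: verts_eq)
  with n_ge assms show ?thesis
    by (auto simp: in_dist_nbhd_iff verts_eq)
qed

section \<open>The two directions of the equivalence\<close>

lemma distance_magic_imp:
  assumes "3 \<le> k" and "distance_magic k"
  shows "m * (m - 1) \<le> 2 * n \<and> k = n"
proof -
  from assms(2) obtain f M where ex: "\<exists>x\<in>verts G. \<exists>y\<in>verts G. y \<in> \<partial>N k x"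
    and bij: "bij_betw f (verts G) {1..m + n}"
    and magic: "\<And>x. x \<in> verts G \<Longrightarrow> \<partial>N k x \<noteq> {} \<Longrightarrow> (\<Sum>w\<in>\<partial>N k x. f w) = M"
    unfolding distance_magic_def distance_magic_labeling_def card_verts by blast
  have inj: "inj_on f (verts G)" using bij by (rule bij_betw_imp_inj_on)
  have "k \<le> n"
    using ex \<open>3 \<le> k\<close> by (auto simp: in_dist_nbhd_iff dest!: height_le)
  have "1 \<in> {1..m}" using m_ge by simp
  with dist_nbhd_v[of k 1] magic[of "v 1"] \<open>3 \<le> k\<close> \<open>k \<le> n\<close> have uk: "f (u k) = M"
    by (simp add: verts_eq)
  have "k = n"
  proof (rule ccontr)
    assume "k \<noteq> n"
    with \<open>k \<le> n\<close> have "k < n" by simp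
    with dist_nbhd_u_1[of k] magic[of "u 1"] \<open>3 \<le> k\<close> have "f (u (k + 1)) = f (u k)"
      using uk by (simp add: verts_eq)
    moreover have "u (k + 1) \<in> verts G" "u k \<in> verts G"
      using \<open>3 \<le> k\<close> \<open>k < n\<close> by (auto simp: verts_eq)
    ultimately have "u (k + 1) = u k"
      using inj by (auto dest: inj_onD)
    with inj_onD[OF inj_u, of "k + 1" k] \<open>3 \<le> k\<close> \<open>k < n\<close> show False by simp
  qed
  have "u n \<in> verts G" using n_ge by (simp add: verts_eq)
  have V: "v ` {1..m} \<subseteq> verts G" by (simp add: verts_eq)
  define S where "S = f ` v ` {1..m}"
  have "card S = m"
    using inj_on_subset[OF inj V] inj_v by (simp add: S_def card_image)
  have S_sub: "S \<subseteq> {1..m + n}"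
    using bij V by (auto simp: S_def bij_betw_def)
  have "0 \<notin> S" using S_sub by auto
  then have "\<Sum>{1..m} \<le> \<Sum>S"
    using sum_atLeast1_card_le[of S] finite_subset[OF S_sub] \<open>card S = m\<close> by simp
  also have "\<Sum>S = (\<Sum>w\<in>v ` {1..m}. f w)"
    using inj_on_subset[OF inj V] by (simp add: S_def sum.reindex)
  also have "\<dots> = M"
    using magic[OF \<open>u n \<in> verts G\<close>] \<open>k = n\<close> dist_nbhd_u_n m_ge by auto
  \<comment> \<open>\<open>M\<close> is itself a label, that of \<open>u n\<close>.\<close>
  also have "M \<le> m + n"
    using uk \<open>k = n\<close> bij \<open>u n \<in> verts G\<close> by (force simp: bij_betw_def)
  finally have "2 * \<Sum>{1..m} \<le> 2 * (m + n)" by simp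
  moreover have "2 * \<Sum>{1..m} = m * (m + 1)"
    using double_gauss_sum_from_Suc_0[of m, where ?'a = nat] by (simp add: One_nat_def)
  ultimately have "m * (m - 1) \<le> 2 * n"
    by (simp add: algebra_simps)
  with \<open>k = n\<close> show ?thesis by simp
qed

lemma imp_distance_magic:
  assumes "m * (m - 1) \<le> 2 * n"
  shows "distance_magic n"
proof -
  define T where "T = \<Sum>{1..m}"
  have T2: "2 * T = m * (m + 1)"
    using double_gauss_sum_from_Suc_0[of m, where ?'a = nat] by (simp add: T_def One_nat_def)
  \<comment> \<open>The label \<open>T\<close> intended for \<open>u n\<close> must not be among the
    bristle labels; this needs \<open>m \<ge> 2\<close>.\<close>
  have "m < T"
  proof -
    have "m * 3 \<le> m * (m + 1)" using m_ge by simp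
    with T2 m_ge show ?thesis by linarith
  qed
  have "m * (m + 1) = m * (m - 1) + 2 * m"
    by (cases m) (simp_all add: algebra_simps)
  with T2 assms have "T \<le> m + n" by linarith
  have T_range: "T - m \<in> {1..n}" using \<open>m < T\<close> \<open>T \<le> m + n\<close> by auto
  \<comment> \<open>The path receives the labels above \<open>m\<close>; the swap gives
    \<open>u n\<close> the label \<open>m + (T - m) = T\<close>.\<close>
  define \<sigma> where "\<sigma> = transpose n (T - m)"
  have \<sigma>: "bij_betw \<sigma> {1..n} {1..n}"
    using T_range n_ge unfolding \<sigma>_def by simp
  define f where
    "f x = (if x \<in> v ` {1..m} then the_inv_into {1..m} v x else m + \<sigma> (height x))" for x
  have f_v: "f (v j) = j" if "j \<in> {1..m}" for j
    using that by (simp add: f_def the_inv_into_f_f[OF inj_v])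
  have f_u: "f (u i) = m + \<sigma> i" if "i \<in> {1..n}" for i
  proof -
    have "u i \<notin> v ` {1..m}" using that disjoint_uv by blast
    then show ?thesis using that by (simp add: f_def)
  qed
  have "f ` verts G = {1..m + n}"
  proof -
    have "f ` v ` {1..m} = {1..m}"
      using f_v by (force simp: image_iff)
    moreover have "f ` u ` {1..n} = (+) m ` \<sigma> ` {1..n}"
      using f_u by (force simp: image_iff)
    ultimately have "f ` verts G = {m + 1..m + n} \<union> {1..m}"
      using \<sigma> by (simp add: verts_eq image_Un bij_betw_def image_add_atLeastAtMost add.commute)
    then show ?thesis by auto
  qed
  \<comment> \<open>Surjectivity between finite sets of equal size yields injectivity.\<close>
  then have "bij_betw f (verts G) {1..m + n}"
    by (simp add: bij_betw_def eq_card_imp_inj_on card_verts)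
  moreover have "(\<Sum>w\<in>\<partial>N n x. f w) = T" if "x \<in> verts G" and "\<partial>N n x \<noteq> {}" for x
  proof -
    have f_u_n: "f (u n) = T"
      using f_u[of n] n_ge \<open>m < T\<close> by (simp add: \<sigma>_def)
    have "{1..n} = insert n {1..<n}" using n_ge by auto
    then have "x \<in> insert (u n) (u ` {1..<n}) \<union> v ` {1..m}"
      using that(1) unfolding verts_eq by simp
    then consider
        (less) i where "i \<in> {1..<n}" "x = u i"
      | (last) "x = u n"
      | (bristle) j where "j \<in> {1..m}" "x = v j"
      by blast
    then show ?thesis
    proof cases
      case less
      with that(2) dist_nbhd_u_less show ?thesis by simp
    next
      case last
      have "(\<Sum>w\<in>v ` {1..m}. f w) = (\<Sum>j=1..m. f (v j))"
        by (simp add: sum.reindex[OF inj_v])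
      also have "\<dots> = T"
        unfolding T_def using f_v by (intro sum.cong) auto
      finally show ?thesis
        using last dist_nbhd_u_n by simp
    next
      case bristle
      with dist_nbhd_v[of n j] n_ge f_u_n show ?thesis by simp
    qed
  qed
  moreover have "\<exists>x\<in>verts G. \<exists>y\<in>verts G. y \<in> \<partial>N n x"
  proof (intro bexI)
    show "v 1 \<in> \<partial>N n (u n)" using dist_nbhd_u_n m_ge by auto
  qed (use n_ge m_ge in \<open>auto simp: verts_eq\<close>)
  ultimately have "distance_magic_labeling n f T"
    using n_ge by (simp add: distance_magic_labeling_def card_verts)
  then show ?thesis
    unfolding distance_magic_def by blast
qed

end

theorem theorem3p1:
  fixes G :: "('a, 'b) pre_digraph" and k m n :: nat
  assumes "graph G" and "graph.long_brush G n m"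
    and "3 \<le> k" and "3 \<le> n" and "2 \<le> m"
  shows "graph.distance_magic G k \<longleftrightarrow> m * (m - 1) \<le> 2 * n \<and> k = n"
proof -
  interpret graph G by fact
  from assms(2) obtain u v where uv: "inj_on u {1..n}" "inj_on v {1..m}"
    "u ` {1..n} \<inter> v ` {1..m} = {}" "verts G = u ` {1..n} \<union> v ` {1..m}"
    "\<forall>i\<in>{1..n}. \<forall>j\<in>{1..n}. u i \<rightarrow>\<^bsub>G\<^esub> u j \<longleftrightarrow> j = i + 1 \<or> i = j + 1"
    "\<forall>i\<in>{1..n}. \<forall>j\<in>{1..m}. u i \<rightarrow>\<^bsub>G\<^esub> v j \<longleftrightarrow> i = 1"
    unfolding long_brush_def by blast
  then interpret long_brush_graph G u v n m
    using uv assms(4,5) by unfold_locales auto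
  show ?thesis
    using distance_magic_imp[OF \<open>3 \<le> k\<close>] imp_distance_magic by blast
qed

end
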